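(* Let $N\ge 2$ be an integer and let $m,p,q,\sigma,\tau$ be real numbers. Set $k:=m+q-p+1$ and $\ell:=q+1-\sigma-\tau$, and assume that $1<p\le N+\sigma$, $\min\{k,\ell\}>0$ and $m,q\in[0,\infty)$. Let $\Omega\subseteq\mathbb{R}^N$ be a domain containing the origin and let $u$ be an arbitrary positive solution of $$\mathrm{div}\left(|x|^{\sigma}|\nabla u|^{p-2}\nabla u\right)=|x|^{-\tau}u^q|\nabla u|^m\quad\text{in }\Omega\setminus\{0\}.$$ If $k>\ell$, then $u\in L^\infty_{\mathrm{loc}}(\Omega)$. If $k\le\ell$, then there exists a positive constant $c_1$ depending only on $m,N,p,q,\sigma$ and $\tau$ such that for every $r_0>0$ with $\overline{B_{2r_0}(0)}\subset\Omega$ and all $0<|x|<r_0$, $$u(x)\le\begin{cases}\displaystyle\max_{\partial B_{r_0}(0)}u+c_1\log(r_0/|x|)&\text{if }k=\ell,\\[2mm]\displaystyle\max_{\partial B_{r_0}(0)}u+c_1|x|^{1-\frac{\ell}{k}}&\text{if }k<\ell.\end{cases}$$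
   Context: A positive solution of the equation is a positive function $u\in C^2(\Omega\setminus\{0\})$ satisfying the equation in the classical sense. $B_r(0)$ is the open ball of radius $r$ centred at $0$ in $\mathbb{R}^N$. *)

theory Defs
  imports "HOL-Analysis.Analysis"
begin

definition gradient :: "('a::euclidean_space \<Rightarrow> real) \<Rightarrow> 'a \<Rightarrow> 'a" where
  "gradient u x = (THE D. GDERIV u x :> D)"

lemma gradient_eqI:
  assumes "GDERIV u x :> D"
  shows "gradient u x = D"
  unfolding gradient_def
proof (rule the_equality)
  fix E assume "GDERIV u x :> E"
  with assms have "(\<lambda>h. inner h E) = (\<lambda>h. inner h D)"
    unfolding gderiv_def by (rule has_derivative_unique[rotated])
  then have "inner h (E - D) = 0" for h
    by (metis inner_diff_right right_minus_eq)
  then show "E = D"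
    using inner_eq_zero_iff[of "E - D"] by simp
qed (rule assms)

(* For open S this is the class C^2(S): G is the gradient on S, and H is its
   derivative (the Hessian), continuous with respect to the operator norm. *)
definition C2_on :: "('a::euclidean_space) set \<Rightarrow> ('a \<Rightarrow> real) \<Rightarrow> bool" where
  "C2_on S u \<longleftrightarrow>
     (\<exists>(G :: 'a \<Rightarrow> 'a) (H :: 'a \<Rightarrow> 'a \<Rightarrow>\<^sub>L 'a).
        (\<forall>x\<in>S. GDERIV u x :> G x) \<and>
        (\<forall>x\<in>S. (G has_derivative blinfun_apply (H x)) (at x)) \<and>
        continuous_on S H)"

(* Pointwise divergence: every partial derivative of a component of F in the
   corresponding coordinate direction exists at x, and these add up to d.  Only these
   partial derivatives are required, since for p < 2 the flux below need not be
   Frechet differentiable at a critical point of u. *)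
definition has_divergence :: "('a::euclidean_space \<Rightarrow> 'a) \<Rightarrow> real \<Rightarrow> 'a \<Rightarrow> bool" where
  "has_divergence F d x \<longleftrightarrow>
     (\<exists>D. (\<forall>b\<in>Basis. ((\<lambda>t. inner (F (x + t *\<^sub>R b)) b) has_real_derivative D b) (at 0)) \<and>
          d = (\<Sum>b\<in>Basis. D b))"

(* At a critical point the vector |grad u|^(p-2) grad u is 0 for every p > 1, which is
   what the term below evaluates to. *)
definition flux :: "real \<Rightarrow> real \<Rightarrow> ('a::euclidean_space \<Rightarrow> real) \<Rightarrow> 'a \<Rightarrow> 'a" where
  "flux p \<sigma> u x =
     (norm x powr \<sigma>) *\<^sub>R ((norm (gradient u x) powr (p - 2)) *\<^sub>R gradient u x)"

(* In the library 0 powr 0 = 0; here m = 0 means that the gradient factor is absent, so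
   |grad u|^0 = 1 also at critical points.  The bases norm x and u x of the other
   powers are positive where the equation is imposed. *)
definition absorption ::
    "real \<Rightarrow> real \<Rightarrow> real \<Rightarrow> ('a::euclidean_space \<Rightarrow> real) \<Rightarrow> 'a \<Rightarrow> real" where
  "absorption m q \<tau> u x =
     norm x powr (- \<tau>) * u x powr q *
     (if m = 0 then 1 else norm (gradient u x) powr m)"

definition positive_solution ::
    "real \<Rightarrow> real \<Rightarrow> real \<Rightarrow> real \<Rightarrow> real \<Rightarrow> ('a::euclidean_space) set \<Rightarrow> ('a \<Rightarrow> real) \<Rightarrow> bool" where
  "positive_solution m p q \<sigma> \<tau> \<Omega> u \<longleftrightarrow>
     C2_on (\<Omega> - {0}) u \<and>
     (\<forall>x\<in>\<Omega> - {0}. 0 < u x) \<and>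
     (\<forall>x\<in>\<Omega> - {0}. has_divergence (flux p \<sigma> u) (absorption m q \<tau> u x) x)"

definition Linfty_loc :: "('a::euclidean_space) set \<Rightarrow> ('a \<Rightarrow> real) \<Rightarrow> bool" where
  "Linfty_loc \<Omega> u \<longleftrightarrow>
     (\<forall>K. compact K \<and> K \<subseteq> \<Omega> \<longrightarrow>
        u \<in> borel_measurable (lebesgue_on K) \<and>
        (\<exists>C. AE x in lebesgue_on K. \<bar>u x\<bar> \<le> C))"

end

theory Submission
  imports Defs
begin

text \<open>
  At an interior maximum of \<open>u - \<phi>(|x|)\<close> with \<open>\<phi>' < 0\<close> both gradients agree and are nonzero, so the
  operator is elliptic there and the equation for \<open>u\<close> transfers to a one-sided inequality for \<open>\<phi>\<close>.
  Hence \<open>u\<close> can be compared with radial strict supersolutions on annuli.  Let \<open>M\<close> bound \<open>u\<close> on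
  \<open>|x| = \<rho>\<close>.  Only points where \<open>u\<close> exceeds the barrier matter, so as \<open>q \<ge> 0\<close> the
  absorption may be evaluated at the barrier without \<open>M\<close>, and because \<open>k > 0\<close> the function \<open>M + c \<rho>\<^sup>\<alpha>\<^sup>+\<^sup>b (|x| - \<rho>/4)\<^sup>-\<^sup>\<alpha>\<close> with
  \<open>b = 1 - l/k\<close>, \<open>\<alpha> = (1 + q)/k\<close>, which blows up on the inner sphere, is a supersolution for a universal \<open>c\<close>.
  This gives \<open>u \<le> M + C \<rho>\<^sup>b\<close> on \<open>\<rho>/2 \<le> |x| \<le> \<rho>\<close>.  Summing over dyadic shells yields a
  bounded, logarithmic or power-type bound according to the sign of \<open>b\<close>.  If \<open>b = 0\<close>, the
  outermost shell needs a separate logarithmic barrier, since the bound has to vanish at \<open>|x| = r\<^sub>0\<close>.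
\<close>

section \<open>Second-order conditions at a maximum\<close>

text \<open>Along the line through \<open>x\<close> in direction \<open>h\<close> the slope of
  \<open>f\<close> is 0 at \<open>x\<close>. If the form were positive, the slope would be positive
  just after \<open>x\<close>, and the mean value theorem would lift \<open>f\<close> above its
  maximum.\<close>

lemma local_max_second_order:
  fixes f :: "'a::euclidean_space \<Rightarrow> real"
  assumes S: "open S" "x \<in> S"
    and f: "\<And>y. y \<in> S \<Longrightarrow> GDERIV f y :> G y"
    and G: "(G has_derivative H) (at x)"
    and max: "\<And>y. y \<in> S \<Longrightarrow> f y \<le> f x"
  shows "G x = 0" and "inner h (H h) \<le> 0"
proof -
  have "(\<lambda>h. inner h (G x)) = (\<lambda>h. 0)"
    using differential_zero_maxmin[OF S(2,1), of f "\<lambda>h. inner h (G x)"] f[OF S(2)] max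
    by (auto simp: gderiv_def)
  then show G0: "G x = 0"
    by (metis inner_eq_zero_iff)
  show "inner h (H h) \<le> 0"
  proof (rule ccontr)
    assume "\<not> inner h (H h) \<le> 0"
    then have pos: "inner h (H h) > 0" by simp
    define l where "l = (\<lambda>t::real. x + t *\<^sub>R h)"
    have l: "(l has_derivative (\<lambda>t. t *\<^sub>R h)) (at t)" for t
      unfolding l_def by (auto intro!: derivative_eq_intros)
    have "((\<lambda>t. G (l t)) has_derivative (\<lambda>t. H (t *\<^sub>R h))) (at 0)"
      by (rule has_derivative_compose[OF l]) (use G in \<open>simp add: l_def\<close>)
    from has_derivative_inner_right[OF this, of h]
    have "((\<lambda>t. inner h (G (l t))) has_real_derivative inner h (H h)) (at 0)"
      using has_derivative_linear[OF G]
      by (simp add: has_field_derivative_def linear_scale mult.commute[of _ "inner h (H h)"])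
    from DERIV_pos_inc_right[OF this pos] G0
    obtain d where d: "d > 0" "\<And>t. 0 < t \<Longrightarrow> t < d \<Longrightarrow> inner h (G (l t)) > 0"
      by (auto simp: l_def)
    have "open (l -` S)"
      unfolding l_def by (rule open_vimage[OF S(1)]) (intro continuous_intros)
    moreover have "0 \<in> l -` S" using S by (simp add: l_def)
    ultimately obtain e where e: "e > 0" "ball 0 e \<subseteq> l -` S"
      by (meson openE)
    \<comment> \<open>Small enough for both purposes: the slope is positive on (0, T], and the
      segment up to T stays in \<open>S\<close>.\<close>
    define T where "T = min d e / 2"
    have T: "T > 0" "T < d" "T < e" using d e by (auto simp: T_def)
    have inS: "l t \<in> S" if "0 \<le> t" "t \<le> T" for t
      using e(2) that T by (auto simp: subset_iff)
    have der: "((\<lambda>t. f (l t)) has_real_derivative inner h (G (l t))) (at t)"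
      if "0 \<le> t" "t \<le> T" for t
    proof -
      have "((\<lambda>t. f (l t)) has_derivative (\<lambda>s. inner (s *\<^sub>R h) (G (l t)))) (at t)"
        by (rule has_derivative_compose[OF l]) (use f[OF inS[OF that]] in \<open>simp add: gderiv_def\<close>)
      then show ?thesis
        by (simp add: has_field_derivative_def mult.commute[of _ "inner h _"])
    qed
    obtain z where z: "0 < z" "z < T" "f (l T) - f (l 0) = (T - 0) * inner h (G (l z))"
      using MVT2[OF T(1), of "\<lambda>t. f (l t)" "\<lambda>t. inner h (G (l t))"] der by auto
    have "T * inner h (G (l z)) > 0"
      using d(2)[of z] z T by (intro mult_pos_pos) auto
    with z(3) have "f (l T) > f (l 0)" by simp
    with max[OF inS[of T]] T show False by (simp add: l_def)
  qed
qed

lemma trace_le_quadratic_form: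
  fixes A :: "'a::euclidean_space \<Rightarrow> 'a"
  assumes "linear A" and nonpos: "\<And>h. inner h (A h) \<le> 0" and "norm e = 1"
  shows "(\<Sum>b\<in>Basis. inner b (A b)) \<le> inner e (A e)"
proof -
  \<comment> \<open>The difference is half the sum over \<open>b\<close>, \<open>c\<close> of the form at \<open>(e \<bullet> b) c - (e \<bullet> c) b\<close>;
    no symmetry of \<open>A\<close> is needed.\<close>
  interpret linear A by fact
  define a where "a = (\<lambda>b. inner e b)"
  define B where "B = (\<lambda>b c. inner b (A c))"
  have e: "e = (\<Sum>b\<in>Basis. a b *\<^sub>R b)" by (simp add: a_def euclidean_representation)
  have a2: "(\<Sum>b\<in>Basis. a b * a b) = 1"
    using assms(3) euclidean_inner[of e e] by (simp add: a_def norm_eq_1)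
  have "inner e (A e) = inner (\<Sum>b\<in>Basis. a b *\<^sub>R b) (A (\<Sum>c\<in>Basis. a c *\<^sub>R c))"
    using e by simp
  also have "\<dots> = (\<Sum>b\<in>Basis. \<Sum>c\<in>Basis. a b * a c * B c b)"
    by (simp add: sum scale inner_sum_left inner_sum_right B_def sum_distrib_left mult.assoc)
  finally have eAe: "inner e (A e) = (\<Sum>b\<in>Basis. \<Sum>c\<in>Basis. a b * a c * B c b)" .
  have "(\<Sum>b\<in>Basis. \<Sum>c\<in>Basis. a b * a b * B c c + a c * a c * B b b
           - a b * a c * B b c - a b * a c * B c b) \<le> (0::real)"
  proof (intro sum_nonpos)
    fix b c :: 'a
    show "a b * a b * B c c + a c * a c * B b b - a b * a c * B b c - a b * a c * B c b \<le> 0"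
      using nonpos[of "a b *\<^sub>R c - a c *\<^sub>R b"]
      by (simp add: diff scale inner_diff_left inner_diff_right B_def algebra_simps)
  qed
  moreover have "(\<Sum>b\<in>Basis. \<Sum>c\<in>Basis. a b * a b * B c c) = (\<Sum>c\<in>Basis. B c c)"
    by (simp add: sum_distrib_left[symmetric] sum_distrib_right[symmetric] a2)
  moreover have "(\<Sum>b\<in>Basis. \<Sum>c\<in>Basis. a c * a c * B b b) = (\<Sum>c\<in>Basis. B c c)"
    by (simp add: sum_distrib_left[symmetric] sum_distrib_right[symmetric] a2)
  moreover have "(\<Sum>b\<in>Basis. \<Sum>c\<in>Basis. a b * a c * B c b)
      = (\<Sum>b\<in>Basis. \<Sum>c\<in>Basis. a b * a c * B b c)"
    by (subst sum.swap) (simp add: mult.commute mult.left_commute)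
  moreover have "(\<Sum>b\<in>Basis. inner b (A b)) = (\<Sum>c\<in>Basis. B c c)"
    by (simp add: B_def)
  ultimately show ?thesis
    unfolding eAe by (simp add: sum.distrib sum_subtractf)
qed

section \<open>The operator at noncritical points and on radial functions\<close>

lemma has_divergence_unique:
  assumes "has_divergence F d x" and "has_divergence F d' x"
  shows "d = d'"
  using assms unfolding has_divergence_def by (metis (no_types, lifting) DERIV_unique sum.cong)

text \<open>Non-divergence form of the operator, with \<open>G\<close> in the role of the gradient
  and \<open>H\<close> of the Hessian. Where \<open>G x\<close> is nonzero the powers of its norm
  are differentiable for every \<open>p\<close>, so the product and chain rules apply. The factor
  \<open>p - 2\<close> collects the second derivative in the direction of the gradient.\<close>

lemma has_divergence_weighted_power:
  fixes G :: "'a::euclidean_space \<Rightarrow> 'a"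
  assumes S: "open S" "x \<in> S"
    and F: "\<And>y. y \<in> S \<Longrightarrow> F y = (norm y powr \<sigma>) *\<^sub>R ((norm (G y) powr (p - 2)) *\<^sub>R G y)"
    and G: "(G has_derivative H) (at x)" and x: "x \<noteq> 0" and Gx: "G x \<noteq> 0"
  shows "has_divergence F
    (norm x powr \<sigma> * norm (G x) powr (p - 2) *
      (\<sigma> * inner (sgn x) (G x) / norm x + (\<Sum>b\<in>Basis. inner b (H b))
        + (p - 2) * inner (sgn (G x)) (H (sgn (G x))))) x"
proof -
  have "linear H" using has_derivative_linear[OF G] .
  then interpret linear H .
  define g where "g = norm (G x)"
  define D where "D = (\<lambda>b. \<sigma> * norm x powr (\<sigma> - 1) * inner (sgn x) b * (g powr (p - 2) * inner (G x) b)
    + norm x powr \<sigma> * ((p - 2) * g powr (p - 2 - 1) * inner (sgn (G x)) (H b) * inner (G x) b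
                        + g powr (p - 2) * inner b (H b)))"
  have der: "((\<lambda>t. inner (F (x + t *\<^sub>R b)) b) has_real_derivative D b) (at 0)"
    if b: "b \<in> Basis" for b
  proof -
    define l where "l = (\<lambda>t::real. x + t *\<^sub>R b)"
    have l: "(l has_derivative (\<lambda>t. t *\<^sub>R b)) (at 0)"
      unfolding l_def by (auto intro!: derivative_eq_intros)
    have Gl: "((\<lambda>t. G (l t)) has_derivative (\<lambda>t. H (t *\<^sub>R b))) (at 0)"
      by (rule has_derivative_compose[OF l]) (use G in \<open>simp add: l_def\<close>)
    have "((\<lambda>t. norm (l t)) has_derivative (\<lambda>t. inner (t *\<^sub>R b) (sgn (l 0)))) (at 0)"
      by (rule has_derivative_compose[OF l]) (use has_derivative_norm[OF x] in \<open>simp add: l_def\<close>)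
    then have 1: "((\<lambda>t. norm (l t)) has_real_derivative inner (sgn x) b) (at 0)"
      by (simp add: has_field_derivative_def l_def inner_commute mult.commute[of _ "inner b _"])
    have "((\<lambda>t. norm (G (l t))) has_derivative (\<lambda>t. inner (H (t *\<^sub>R b)) (sgn (G (l 0))))) (at 0)"
      by (rule has_derivative_compose[OF Gl]) (use has_derivative_norm[OF Gx] in \<open>simp add: l_def\<close>)
    then have 2: "((\<lambda>t. norm (G (l t))) has_real_derivative inner (sgn (G x)) (H b)) (at 0)"
      by (simp add: has_field_derivative_def l_def scale inner_commute mult.commute[of _ "inner _ (sgn _)"] mult.commute[of _ "inner (sgn _) _"])
    have 3: "((\<lambda>t. inner (G (l t)) b) has_real_derivative inner b (H b)) (at 0)"
      using has_derivative_inner_left[OF Gl, of b]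
      by (simp add: has_field_derivative_def scale inner_commute mult.commute[of _ "inner b _"])
    have n: "norm (l 0) > 0" "norm (G (l 0)) > 0" using x Gx by (auto simp: l_def)
    have "((\<lambda>t. norm (l t) powr \<sigma> * (norm (G (l t)) powr (p - 2) * inner (G (l t)) b))
        has_real_derivative D b) (at 0)"
      by (rule derivative_eq_intros DERIV_fun_powr[OF 1 n(1)] DERIV_fun_powr[OF 2 n(2)] 3 refl)+
        (simp add: D_def l_def g_def algebra_simps)
    \<comment> \<open>The formula for \<open>F\<close> is available on \<open>S\<close> only, so the
      derivative is transferred through equality near \<open>t = 0\<close>.\<close>
    moreover have "\<forall>\<^sub>F t in nhds 0. l t \<in> S"
    proof (rule eventually_nhds_in_open[of "l -` S" 0, simplified])
      show "open (l -` S)"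
        unfolding l_def by (rule open_vimage[OF S(1)]) (intro continuous_intros)
    qed (use S in \<open>simp add: l_def\<close>)
    then have "\<forall>\<^sub>F t in nhds 0. inner (F (x + t *\<^sub>R b)) b
        = norm (l t) powr \<sigma> * (norm (G (l t)) powr (p - 2) * inner (G (l t)) b)"
      by eventually_elim (simp add: F l_def)
    ultimately show ?thesis
      by (subst DERIV_cong_ev[OF refl _ refl]) auto
  qed
  have s1: "(\<Sum>b\<in>Basis. inner (sgn x) b * inner (G x) b) = inner (sgn x) (G x)"
    by (simp add: euclidean_inner[symmetric])
  have "(\<Sum>b\<in>Basis. inner (sgn (G x)) (H b) * inner (G x) b)
      = inner (sgn (G x)) (H (\<Sum>b\<in>Basis. inner (G x) b *\<^sub>R b))"
    by (simp add: sum scale inner_sum_right mult.commute del: euclidean_representation)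
  also have "\<dots> = inner (sgn (G x)) (H (G x))" by (simp add: euclidean_representation)
  also have "\<dots> = g * inner (sgn (G x)) (H (sgn (G x)))"
    using Gx by (simp add: sgn_div_norm scale g_def)
  finally have s2: "(\<Sum>b\<in>Basis. inner (sgn (G x)) (H b) * inner (G x) b)
      = g * inner (sgn (G x)) (H (sgn (G x)))" .
  have "(\<Sum>b\<in>Basis. D b) = \<sigma> * norm x powr (\<sigma> - 1) * g powr (p - 2) * inner (sgn x) (G x)
      + norm x powr \<sigma> * ((p - 2) * g powr (p - 2 - 1) * (g * inner (sgn (G x)) (H (sgn (G x))))
          + g powr (p - 2) * (\<Sum>b\<in>Basis. inner b (H b)))"
    unfolding s1[symmetric] s2[symmetric] D_def
    unfolding sum_distrib_left sum.distrib[symmetric]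
    by (intro sum.cong refl) (simp add: algebra_simps)
  moreover have "norm x powr (\<sigma> - 1) = norm x powr \<sigma> / norm x"
    "g powr (p - 2 - 1) = g powr (p - 2) / g" "g \<noteq> 0"
    using x Gx powr_diff[of g "p - 2" 1] by (simp_all add: powr_diff[of "norm x"] g_def)
  ultimately have "(\<Sum>b\<in>Basis. D b) = norm x powr \<sigma> * norm (G x) powr (p - 2) *
      (\<sigma> * inner (sgn x) (G x) / norm x + (\<Sum>b\<in>Basis. inner b (H b))
        + (p - 2) * inner (sgn (G x)) (H (sgn (G x))))"
    by (simp add: g_def[symmetric] algebra_simps)
  with der show ?thesis
    unfolding has_divergence_def by metis
qed

text \<open>Here \<psi> stands for the negative of the derivative of \<phi>, hence is positive for a
  decreasing barrier. The Hessian of the radial function acts as \<open>- \<psi> / r\<close> on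
  vectors orthogonal to \<open>x\<close> and as \<open>- d\<close> in the radial direction.\<close>

lemma radial_derivatives:
  fixes x :: "'a::euclidean_space"
  assumes x: "x \<noteq> 0"
  shows "(\<phi> has_real_derivative - \<psi> (norm x)) (at (norm x)) \<Longrightarrow>
      GDERIV (\<lambda>y. \<phi> (norm y)) x :> - (\<psi> (norm x) *\<^sub>R sgn x)"
    and "(\<psi> has_real_derivative d) (at (norm x)) \<Longrightarrow>
      ((\<lambda>y. - (\<psi> (norm y) *\<^sub>R sgn y)) has_derivative
        (\<lambda>h. - (\<psi> (norm x) / norm x) *\<^sub>R h
              - ((d - \<psi> (norm x) / norm x) * inner (sgn x) h) *\<^sub>R sgn x)) (at x)"
proof -
  have n: "(norm has_derivative (\<lambda>h. inner (sgn x) h)) (at x)"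
    using has_derivative_norm[OF x] by (simp add: inner_commute)
  show "GDERIV (\<lambda>y. \<phi> (norm y)) x :> - (\<psi> (norm x) *\<^sub>R sgn x)"
    if "(\<phi> has_real_derivative - \<psi> (norm x)) (at (norm x))"
  proof -
    have "((\<lambda>y. \<phi> (norm y)) has_derivative (\<lambda>h. - \<psi> (norm x) * inner (sgn x) h)) (at x)"
      by (rule has_derivative_compose[OF n]) (fact that[unfolded has_field_derivative_def])
    then show ?thesis by (simp add: gderiv_def inner_commute)
  qed
  show "((\<lambda>y. - (\<psi> (norm y) *\<^sub>R sgn y)) has_derivative
        (\<lambda>h. - (\<psi> (norm x) / norm x) *\<^sub>R h
              - ((d - \<psi> (norm x) / norm x) * inner (sgn x) h) *\<^sub>R sgn x)) (at x)"
    if d: "(\<psi> has_real_derivative d) (at (norm x))"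
  proof -
    have "((\<lambda>y. \<psi> (norm y)) has_derivative (\<lambda>h. d * inner (sgn x) h)) (at x)"
      by (rule has_derivative_compose[OF n]) (use d in \<open>simp add: has_field_derivative_def\<close>)
    moreover have "((\<lambda>y. inverse (norm y)) has_derivative
        (\<lambda>h. - (inverse (norm x) * inner (sgn x) h * inverse (norm x)))) (at x)"
      by (rule Deriv.has_derivative_inverse[OF _ n]) (use x in simp)
    ultimately have "((\<lambda>y. - (\<psi> (norm y) *\<^sub>R (inverse (norm y) *\<^sub>R y))) has_derivative
        (\<lambda>h. - (\<psi> (norm x) *\<^sub>R (inverse (norm x) *\<^sub>R h
            + (- (inverse (norm x) * inner (sgn x) h * inverse (norm x))) *\<^sub>R x)
            + (d * inner (sgn x) h) *\<^sub>R (inverse (norm x) *\<^sub>R x)))) (at x)"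
      by (intro has_derivative_minus has_derivative_scaleR has_derivative_ident)
    then show ?thesis
      unfolding sgn_div_norm
      by (rule has_derivative_eq_rhs) (simp add: fun_eq_iff algebra_simps divide_inverse)
  qed
qed


section \<open>Comparison with radial barriers\<close>

text \<open>The right-hand side is the operator applied to the barrier. On the left the gradient of
  \<open>u\<close> has been replaced by that of the barrier, but the factor
  \<open>u x powr q\<close> is kept.\<close>

lemma touching_inequality:
  fixes u :: "'a::euclidean_space \<Rightarrow> real"
  assumes sol: "positive_solution m p q \<sigma> \<tau> \<Omega> u" and p: "1 < p"
    and S: "open S" "x \<in> S" "S \<subseteq> \<Omega> - {0}"
    and \<phi>: "\<And>y. y \<in> S \<Longrightarrow> (\<phi> has_real_derivative - \<psi> (norm y)) (at (norm y))"
    and \<psi>: "(\<psi> has_real_derivative d) (at (norm x))" and pos: "\<psi> (norm x) > 0"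
    and max: "\<And>y. y \<in> S \<Longrightarrow> u y - \<phi> (norm y) \<le> u x - \<phi> (norm x)"
  shows "norm x powr (- \<tau>) * u x powr q * \<psi> (norm x) powr m
    \<le> - (norm x powr \<sigma> * \<psi> (norm x) powr (p - 2) *
          ((real DIM('a) - 1 + \<sigma>) * \<psi> (norm x) / norm x + (p - 1) * d))"
proof -
  obtain G H where G: "\<And>y. y \<in> \<Omega> - {0} \<Longrightarrow> GDERIV u y :> G y"
    and H: "\<And>y. y \<in> \<Omega> - {0} \<Longrightarrow> (G has_derivative blinfun_apply (H y)) (at y)"
    using sol unfolding positive_solution_def C2_on_def by blast
  have x: "x \<in> \<Omega> - {0}" and x0: "x \<noteq> 0" using S by auto
  define r where "r = norm x"
  define g where "g = \<psi> r"
  define e where "e = sgn x"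
  \<comment> \<open>\<open>Hw\<close> is the Hessian of the barrier at \<open>x\<close>, and
    \<open>A\<close> that of the difference, which is nonpositive as a form.\<close>
  define Hw where "Hw = (\<lambda>h. - (g / r) *\<^sub>R h - ((d - g / r) * inner e h) *\<^sub>R e)"
  define A where "A = (\<lambda>h. H x h - Hw h)"
  have r: "r > 0" and g: "g > 0" and e: "norm e = 1" "inner e e = 1"
    using x0 pos by (auto simp: r_def g_def e_def norm_sgn dot_square_norm)
  have diff: "GDERIV (\<lambda>y. u y - \<phi> (norm y)) y :> G y - - (\<psi> (norm y) *\<^sub>R sgn y)"
    if "y \<in> S" for y
    using that S by (intro GDERIV_diff G radial_derivatives \<phi>) auto
  have dA: "((\<lambda>y. G y - - (\<psi> (norm y) *\<^sub>R sgn y)) has_derivative A) (at x)"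
    unfolding A_def Hw_def g_def r_def e_def
    by (intro has_derivative_diff H x radial_derivatives x0 \<psi>)
  note second = local_max_second_order[OF S(1,2) diff dA max]
  have Gx: "G x = - (g *\<^sub>R e)"
    using second(1) by (simp add: g_def r_def e_def eq_neg_iff_add_eq_0)
  then have Gx0: "G x \<noteq> 0" and nG: "norm (G x) = g" and sG: "sgn (G x) = - e"
    using g e(1) by (auto simp: sgn_minus sgn_scaleR sgn_div_norm[of e])
  have "flux p \<sigma> u y = (norm y powr \<sigma>) *\<^sub>R ((norm (G y) powr (p - 2)) *\<^sub>R G y)"
    if "y \<in> S" for y
  proof -
    have "y \<in> \<Omega> - {0}" using that S by auto
    from gradient_eqI[OF G[OF this]] show ?thesis by (simp add: flux_def)
  qed
  note div = has_divergence_weighted_power[OF S(1,2) this H[OF x] x0 Gx0]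
  have "has_divergence (flux p \<sigma> u) (absorption m q \<tau> u x) x"
    using sol x by (auto simp: positive_solution_def)
  \<comment> \<open>Since \<open>g > 0\<close>, \<open>g powr 0 = 1\<close>, so the separate case
    \<open>m = 0\<close> in \<open>absorption\<close> agrees with the power.\<close>
  moreover have "absorption m q \<tau> u x = r powr (- \<tau>) * u x powr q * g powr m"
    using gradient_eqI[OF G[OF x]] nG g by (simp add: absorption_def r_def)
  ultimately have eq: "r powr (- \<tau>) * u x powr q * g powr m
    = r powr \<sigma> * g powr (p - 2) *
      (\<sigma> * inner e (G x) / r + (\<Sum>b\<in>Basis. inner b (H x b)) + (p - 2) * inner e (H x e))"
    using has_divergence_unique[OF _ div] nG sG
    by (simp add: r_def e_def blinfun.minus_right)
  have "linear A" using has_derivative_linear[OF dA] .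
  then have tr: "(\<Sum>b\<in>Basis. inner b (A b)) \<le> inner e (A e)"
    using second(2) e(1) by (rule trace_le_quadratic_form)
  \<comment> \<open>For p < 2 the term with \<open>p - 2\<close> has the wrong sign. Bounding the
    trace by the single value \<open>inner e (A e)\<close> turns its coefficient into
    \<open>p - 1\<close>, which is positive.\<close>
  have "(\<Sum>b\<in>Basis. inner b (A b)) + (p - 2) * inner e (A e) \<le> (p - 1) * inner e (A e)"
    using tr by (simp add: algebra_simps)
  also have "\<dots> \<le> 0"
    using second(2)[of e] p by (simp add: mult_nonneg_nonpos)
  finally have "(\<Sum>b\<in>Basis. inner b (H x b)) + (p - 2) * inner e (H x e)
      \<le> (\<Sum>b\<in>Basis. inner b (Hw b)) + (p - 2) * inner e (Hw e)"
    by (simp add: A_def inner_diff_right sum_subtractf right_diff_distrib)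
  moreover have "inner e (Hw e) = - d"
    using e by (simp add: Hw_def inner_diff_right)
  \<comment> \<open>\<open>N - 1\<close> tangential eigenvalues \<open>- g / r\<close> and one
    radial eigenvalue \<open>- d\<close>.\<close>
  moreover have "(\<Sum>b\<in>Basis. inner b (Hw b)) = - (real DIM('a) * (g / r)) - (d - g / r)"
  proof -
    have "(\<Sum>b\<in>Basis. inner b (Hw b))
        = (\<Sum>b\<in>(Basis::'a set). - (g / r)) - (d - g / r) * (\<Sum>b\<in>Basis. inner e b * inner e b)"
      unfolding sum_distrib_left sum_subtractf[symmetric]
      by (intro sum.cong refl) (simp add: Hw_def inner_diff_right inner_commute[of _ e])
    then show ?thesis using e(2) by (simp add: euclidean_inner[of e e])
  qed
  moreover have "\<sigma> * inner e (G x) / r = - (\<sigma> * g / r)"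
    using e(2) by (simp add: Gx)
  ultimately have "\<sigma> * inner e (G x) / r + (\<Sum>b\<in>Basis. inner b (H x b)) + (p - 2) * inner e (H x e)
      \<le> - ((real DIM('a) - 1 + \<sigma>) * g / r + (p - 1) * d)"
    by (simp add: algebra_simps add_divide_distrib diff_divide_distrib)
  then have "r powr (- \<tau>) * u x powr q * g powr m
      \<le> r powr \<sigma> * g powr (p - 2) * - ((real DIM('a) - 1 + \<sigma>) * g / r + (p - 1) * d)"
    unfolding eq by (intro mult_left_mono) auto
  then show ?thesis unfolding r_def g_def by (simp only: mult_minus_right)
qed

lemma positive_solution_continuous_on:
  assumes "positive_solution m p q \<sigma> \<tau> \<Omega> u"
  shows "continuous_on (\<Omega> - {0}) u"
proof -
  have "isCont u y" if "y \<in> \<Omega> - {0}" for y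
    using assms that has_derivative_continuous
    unfolding positive_solution_def C2_on_def gderiv_def by blast
  then show ?thesis by (simp add: continuous_at_imp_continuous_on)
qed

text \<open>If the claim failed, \<open>u\<close> minus the barrier would have a positive maximum
  over the closed annulus. By \<open>bdry\<close> it is attained inside, where
  \<open>touching_inequality\<close> contradicts the strict inequality in \<open>super\<close>.
  There \<open>v\<close> stands for the value of \<open>u\<close> at that point, hence
  \<open>v > 0\<close> and \<open>\<phi> r < v\<close> may be assumed.\<close>

lemma annulus_comparison:
  fixes u :: "'a::euclidean_space \<Rightarrow> real"
  assumes sol: "positive_solution m p q \<sigma> \<tau> \<Omega> u" and p: "1 < p"
    and s: "0 < s"
    and \<Omega>: "\<And>y. s \<le> norm y \<Longrightarrow> norm y \<le> t \<Longrightarrow> y \<in> \<Omega>"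
    and \<phi>: "\<And>r. s \<le> r \<Longrightarrow> r \<le> t \<Longrightarrow> (\<phi> has_real_derivative - \<psi> r) (at r)"
    and \<psi>: "\<And>r. s < r \<Longrightarrow> r < t \<Longrightarrow> (\<psi> has_real_derivative \<psi>' r) (at r)"
    and pos: "\<And>r. s < r \<Longrightarrow> r < t \<Longrightarrow> \<psi> r > 0"
    and super: "\<And>r v. s < r \<Longrightarrow> r < t \<Longrightarrow> 0 < v \<Longrightarrow> \<phi> r < v \<Longrightarrow>
      - (r powr \<sigma> * \<psi> r powr (p - 2) * ((real DIM('a) - 1 + \<sigma>) * \<psi> r / r + (p - 1) * \<psi>' r))
      < r powr (- \<tau>) * v powr q * \<psi> r powr m"
    and bdry: "\<And>y. norm y = s \<or> norm y = t \<Longrightarrow> u y \<le> \<phi> (norm y)"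
    and x: "s \<le> norm x" "norm x \<le> t"
  shows "u x \<le> \<phi> (norm x)"
proof (rule ccontr)
  assume "\<not> u x \<le> \<phi> (norm x)"
  define K where "K = cball 0 t - ball (0::'a) s"
  have K: "y \<in> K \<longleftrightarrow> s \<le> norm y \<and> norm y \<le> t" for y by (auto simp: K_def)
  have "compact K" unfolding K_def by (intro compact_diff) auto
  moreover have "continuous_on K (\<lambda>y. u y - \<phi> (norm y))"
  proof (intro continuous_intros)
    show "continuous_on K u"
      by (rule continuous_on_subset[OF positive_solution_continuous_on[OF sol]])
        (use \<Omega> s in \<open>auto simp: K\<close>)
    have "continuous_on {s..t} \<phi>"
      by (intro continuous_at_imp_continuous_on ballI DERIV_isCont[OF \<phi>]) auto
    then show "continuous_on K (\<lambda>y. \<phi> (norm y))"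
      by (rule continuous_on_compose2) (auto simp: K intro!: continuous_intros)
  qed
  ultimately obtain z where z: "z \<in> K" and max: "\<And>y. y \<in> K \<Longrightarrow> u y - \<phi> (norm y) \<le> u z - \<phi> (norm z)"
    using continuous_attains_sup[of K "\<lambda>y. u y - \<phi> (norm y)"] x K by blast
  have uz: "u z > \<phi> (norm z)"
    using max[of x] x \<open>\<not> u x \<le> \<phi> (norm x)\<close> by (simp add: K)
  with bdry[of z] have "norm z \<noteq> s" "norm z \<noteq> t" by auto
  with z have nz: "s < norm z" "norm z < t" by (auto simp: K less_le)
  define S where "S = ball 0 t - cball (0::'a) s"
  have S: "y \<in> S \<longleftrightarrow> s < norm y \<and> norm y < t" for y by (auto simp: S_def)
  have "open S" unfolding S_def by auto
  moreover have "S \<subseteq> \<Omega> - {0}" using \<Omega> s by (auto simp: S)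
  moreover have "u z > 0"
    using sol nz s \<Omega>[of z] unfolding positive_solution_def by auto
  ultimately show False
    using touching_inequality[OF sol p, of S z \<phi> \<psi> "\<psi>' (norm z)"] nz \<phi> \<psi> pos max
      super[OF nz _ uz]
    by (force simp: S K)
qed

section \<open>Universal growth estimate on one dyadic shell\<close>

text \<open>The logarithms of \<open>r\<close> and \<rho> differ by at most \<open>ln 4\<close>; the
  absolute value covers both signs of the exponent. This freezes the weight at \<rho>.\<close>

lemma powr_le_four_powr_abs:
  fixes r \<rho> \<theta> :: real
  assumes "0 < \<rho>" "\<rho> / 4 \<le> r" "r \<le> \<rho>"
  shows "r powr \<theta> \<le> 4 powr \<bar>\<theta>\<bar> * \<rho> powr \<theta>"
proof -
  have r: "r > 0" using assms by simp
  have "ln (\<rho> / 4) \<le> ln r" "ln r \<le> ln \<rho>"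
    using assms r by (subst ln_le_cancel_iff; simp)+
  then have "ln \<rho> - ln 4 \<le> ln r" "ln r \<le> ln \<rho>"
    using assms by (simp_all add: ln_div)
  then have "\<bar>ln r - ln \<rho>\<bar> \<le> ln 4" by simp
  then have "\<bar>\<theta>\<bar> * \<bar>ln r - ln \<rho>\<bar> \<le> \<bar>\<theta>\<bar> * ln 4" by (intro mult_left_mono) auto
  then have "\<theta> * (ln r - ln \<rho>) \<le> \<bar>\<theta>\<bar> * ln 4"
    by (metis abs_ge_self abs_mult order_trans)
  then have "\<theta> * ln r \<le> \<bar>\<theta>\<bar> * ln 4 + \<theta> * ln \<rho>" by (simp add: algebra_simps)
  then show ?thesis using r assms by (simp add: powr_def exp_add[symmetric])
qed


text \<open>\<open>C\<close> is fixed before the domain, the solution, the radius and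
  \<open>M\<close>, so the estimate can be repeated on smaller shells with a growing
  \<open>M\<close>. The exponent \<open>1 - l / k\<close> is the one for which both sides of the
  equation scale alike.\<close>

lemma dyadic_step:
  fixes m p q \<sigma> \<tau> k l :: real
  assumes k: "k = m + q - p + 1" "0 < k"
    and l: "l = q + 1 - \<sigma> - \<tau>"
    and p: "1 < p" "p \<le> real DIM('a::euclidean_space) + \<sigma>" and q: "0 \<le> q"
  obtains C where "C > 0"
    and "\<And>\<Omega> (u :: 'a \<Rightarrow> real) \<rho> M x. positive_solution m p q \<sigma> \<tau> \<Omega> u \<Longrightarrow> 0 \<le> M \<Longrightarrow>
      cball 0 \<rho> \<subseteq> \<Omega> \<Longrightarrow> (\<And>y. norm y = \<rho> \<Longrightarrow> u y \<le> M) \<Longrightarrow> 0 < \<rho> \<Longrightarrow>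
      \<rho> / 2 \<le> norm x \<Longrightarrow> norm x \<le> \<rho> \<Longrightarrow> u x \<le> M + C * \<rho> powr (1 - l / k)"
proof -
  define \<alpha> where "\<alpha> = (1 + q) / k"
  \<comment> \<open>The value required of \<open>c powr k\<close>:
    \<open>(p - 1) * (\<alpha> + 1)\<close> comes from \<open>\<psi>'\<close>, the power of 4 from
    freezing the weight, and the power of \<alpha> from the factor \<alpha> in \<psi>, raised to
    \<open>m\<close> on one side and to \<open>p - 1\<close> on the other.\<close>
  define X where "X = (p - 1) * (\<alpha> + 1) * 4 powr \<bar>\<sigma> + \<tau>\<bar> / \<alpha> powr (m - p + 1)"
  define c where "c = X powr (1 / k)"
  have \<alpha>: "\<alpha> > 0" "\<alpha> * k = 1 + q" using q k(2) by (auto simp: \<alpha>_def)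
  have X: "X > 0" using \<alpha> p by (simp add: X_def)
  have c: "c > 0" "c powr k = X" using X k(2) by (auto simp: c_def powr_powr)
  show ?thesis
  proof (rule that[of "c * 4 powr \<alpha>"])
    fix \<Omega> and u :: "'a \<Rightarrow> real" and \<rho> M and x :: 'a
    assume sol: "positive_solution m p q \<sigma> \<tau> \<Omega> u" and M: "0 \<le> M"
      and \<Omega>: "cball 0 \<rho> \<subseteq> \<Omega>" and bd: "\<And>y. norm y = \<rho> \<Longrightarrow> u y \<le> M" and \<rho>: "0 < \<rho>"
      and x: "\<rho> / 2 \<le> norm x" "norm x \<le> \<rho>"
    define b where "b = 1 - l / k"
    \<comment> \<open>The exponent is chosen so that
      \<open>(\<alpha> + b - 1) * k = \<sigma> + \<tau>\<close>, which matches the weight at \<rho>.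
      At distance \<rho>/4 from the singular sphere the excess over \<open>M\<close> is then of
      order \<open>\<rho> powr b\<close>.\<close>
    define K where "K = c * \<rho> powr (\<alpha> + b)"
    define \<phi> where "\<phi> = (\<lambda>r. M + K * (r - \<rho> / 4) powr (- \<alpha>))"
    define \<psi> where "\<psi> = (\<lambda>r. K * \<alpha> * (r - \<rho> / 4) powr (- \<alpha> - 1))"
    define \<psi>' where "\<psi>' = (\<lambda>r. - (\<alpha> + 1) * \<psi> r / (r - \<rho> / 4))"
    have K: "K > 0" using c \<rho> by (simp add: K_def)
    have super: "- (r powr \<sigma> * \<psi> r powr (p - 2) * ((real DIM('a) - 1 + \<sigma>) * \<psi> r / r + (p - 1) * \<psi>' r))
        < r powr (- \<tau>) * v powr q * \<psi> r powr m"
      if r: "\<rho> / 4 < r" "r \<le> \<rho>" and v: "\<phi> r < v" for r v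
    proof -
      define \<delta> where "\<delta> = r - \<rho> / 4"
      define g where "g = \<psi> r"
      have \<delta>: "0 < \<delta>" "\<delta> \<le> \<rho>" and r0: "r > 0" and g: "g > 0"
        using r \<rho> K \<alpha> by (auto simp: \<delta>_def g_def \<psi>_def)
      have gp: "g powr (p - 2) * g = g powr (p - 1)"
        using g powr_add[of g "p - 2" 1] by (simp add: add.commute)
      \<comment> \<open>The hypotheses on \<open>p\<close> give
        \<open>N - 1 + \<sigma> \<ge> p - 1 > 0\<close>, so the first-order term helps. Discarding
        it makes the inequality strict.\<close>
      have "- (r powr \<sigma> * g powr (p - 2) * ((real DIM('a) - 1 + \<sigma>) * g / r + (p - 1) * \<psi>' r))
          < - (r powr \<sigma> * g powr (p - 2) * ((p - 1) * \<psi>' r))"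
      proof -
        have "r powr \<sigma> * g powr (p - 2) * ((real DIM('a) - 1 + \<sigma>) * g / r) > 0"
          using r0 g p by (intro mult_pos_pos divide_pos_pos) auto
        then show ?thesis by (simp add: distrib_left)
      qed
      also have "\<dots> = r powr \<sigma> * (g powr (p - 2) * g) * ((p - 1) * (\<alpha> + 1)) / \<delta>"
      proof -
        have "\<psi>' r = - (\<alpha> + 1) * g / \<delta>" by (simp add: \<psi>'_def \<delta>_def g_def)
        then show ?thesis by (simp only:) (simp add: algebra_simps add_divide_distrib diff_divide_distrib)
      qed
      also have "\<dots> = (r powr (- \<tau>) * g powr (p - 1) / \<delta>) * ((p - 1) * (\<alpha> + 1) * r powr (\<sigma> + \<tau>))"
      proof -
        have "r powr \<sigma> = r powr (- \<tau>) * r powr (\<sigma> + \<tau>)" using r0 by (simp add: powr_add[symmetric])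
        then show ?thesis unfolding gp by (simp only:) (simp only: times_divide_eq_left times_divide_eq_right mult_ac)
      qed
      also have "\<dots> \<le> (r powr (- \<tau>) * g powr (p - 1) / \<delta>) * (\<alpha> powr (m - p + 1) * (K / \<delta>) powr k)"
      proof (intro mult_left_mono)
        have "(p - 1) * (\<alpha> + 1) * r powr (\<sigma> + \<tau>)
            \<le> (p - 1) * (\<alpha> + 1) * (4 powr \<bar>\<sigma> + \<tau>\<bar> * \<rho> powr (\<sigma> + \<tau>))"
          using powr_le_four_powr_abs[of \<rho> r "\<sigma> + \<tau>"] r \<rho> p \<alpha> by (intro mult_left_mono) auto
        also have "\<dots> = \<alpha> powr (m - p + 1) * (c powr k * \<rho> powr (\<sigma> + \<tau>))"
          using \<alpha> by (simp add: c X_def)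
        also have "c powr k * \<rho> powr (\<sigma> + \<tau>) = (c * \<rho> powr (\<alpha> + b - 1)) powr k"
        proof -
          have "(\<alpha> + b - 1) * k = \<sigma> + \<tau>"
            using \<alpha>(2) k(2) l by (simp add: b_def algebra_simps)
          then show ?thesis using c \<rho> by (simp add: powr_mult powr_powr)
        qed
        also have "c * \<rho> powr (\<alpha> + b - 1) = K / \<rho>"
          using \<rho> by (simp add: K_def powr_diff)
        \<comment> \<open>Positivity of \<open>k\<close> allows \<rho> to be replaced by the smaller
          \<delta>, which produces the powers of \<delta> needed on the absorption side.\<close>
        also have "(K / \<rho>) powr k \<le> (K / \<delta>) powr k"
          using K \<delta> \<rho> k(2) by (intro powr_mono2 divide_left_mono) auto
        finally show "(p - 1) * (\<alpha> + 1) * r powr (\<sigma> + \<tau>) \<le> \<alpha> powr (m - p + 1) * (K / \<delta>) powr k"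
          by (simp add: mult_left_mono)
      qed (use \<delta> in auto)
      also have "\<dots> = r powr (- \<tau>) * (K * \<delta> powr (- \<alpha>)) powr q * g powr m"
      proof -
        have g': "g = K * \<alpha> * \<delta> powr (- \<alpha> - 1)" by (simp add: g_def \<psi>_def \<delta>_def)
        \<comment> \<open>\<open>\<alpha> k = 1 + q\<close> makes the powers of \<open>\<delta>\<close> match.\<close>
        have "ln (g powr (p - 1) / \<delta> * (\<alpha> powr (m - p + 1) * (K / \<delta>) powr k))
            = (p - 1) * ln g - ln \<delta> + ((m - p + 1) * ln \<alpha> + k * (ln K - ln \<delta>))"
          using g \<delta> \<alpha> K by (simp add: ln_mult ln_div ln_powr)
        also have "\<dots> = q * (ln K - \<alpha> * ln \<delta>) + m * ln g"
        proof -
          have lg: "ln g = ln K + ln \<alpha> - \<alpha> * ln \<delta> - ln \<delta>"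
            using \<delta> \<alpha> K by (simp add: g' ln_mult ln_powr algebra_simps)
          have mk: "m = k - q + p - 1" using k(1) by simp
          have "\<alpha> * k * ln \<delta> = (1 + q) * ln \<delta>" by (simp add: \<alpha>(2))
          then show ?thesis unfolding lg mk by (simp add: algebra_simps)
        qed
        also have "\<dots> = ln ((K * \<delta> powr (- \<alpha>)) powr q * g powr m)"
          using g \<delta> K by (simp add: ln_mult ln_powr)
        finally have "g powr (p - 1) / \<delta> * (\<alpha> powr (m - p + 1) * (K / \<delta>) powr k)
            = (K * \<delta> powr (- \<alpha>)) powr q * g powr m"
          using g \<delta> \<alpha> K by (subst (asm) ln_inj_iff) auto
        then show ?thesis by (simp only: times_divide_eq_right[symmetric] mult.assoc)
      qed
      also have "\<dots> \<le> r powr (- \<tau>) * v powr q * g powr m"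
        using v M q K \<delta> by (intro mult_right_mono mult_left_mono powr_mono2) (auto simp: \<phi>_def \<delta>_def)
      finally show ?thesis by (simp add: g_def)
    qed
    have d\<phi>: "(\<phi> has_real_derivative - \<psi> r) (at r)" and d\<psi>: "(\<psi> has_real_derivative \<psi>' r) (at r)"
      if "\<rho> / 4 < r" for r
    proof -
      show "(\<phi> has_real_derivative - \<psi> r) (at r)"
        unfolding \<phi>_def \<psi>_def using that by (auto intro!: derivative_eq_intros simp: algebra_simps)
      have "(r - \<rho> / 4) powr (- \<alpha> - 1 - 1) = (r - \<rho> / 4) powr (- \<alpha> - 1) / (r - \<rho> / 4)"
        using that powr_diff[of "r - \<rho> / 4" "- \<alpha> - 1" 1] by simp
      then have "\<psi>' r = K * \<alpha> * ((- \<alpha> - 1) * (r - \<rho> / 4) powr (- \<alpha> - 1 - 1))"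
        unfolding \<psi>'_def \<psi>_def by (simp add: algebra_simps add_divide_distrib diff_divide_distrib)
      then show "(\<psi> has_real_derivative \<psi>' r) (at r)"
        unfolding \<psi>_def using that by (auto intro!: derivative_eq_intros simp: algebra_simps)
    qed
    define A where "A = cball 0 \<rho> - ball (0::'a) (\<rho> / 4)"
    have "compact A" unfolding A_def by (intro compact_diff) auto
    moreover have "continuous_on A u"
      by (rule continuous_on_subset[OF positive_solution_continuous_on[OF sol]])
        (use \<Omega> \<rho> in \<open>auto simp: A_def\<close>)
    ultimately have "bounded (u ` A)"
      by (intro compact_imp_bounded compact_continuous_image)
    then obtain B where B: "B > 0" "\<And>y. y \<in> A \<Longrightarrow> u y \<le> B"
      by (auto simp: bounded_pos) (metis abs_le_D1)
    \<comment> \<open>The comparison starts at \<open>\<rho> / 4 + \<delta>\<close>, where the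
      barrier already exceeds the bound \<open>B\<close> of \<open>u\<close>. \<open>B\<close>
      depends on \<open>u\<close>, but only \<delta> sees it, not the final constant. The cap
      \<rho>/4 keeps the starting radius at most \<rho>/2, so \<open>x\<close> lies in the
      annulus.\<close>
    define \<delta> where "\<delta> = min (\<rho> / 4) ((B / K) powr (- 1 / \<alpha>))"
    have \<delta>: "\<delta> > 0" "\<delta> \<le> \<rho> / 4" using \<rho> B K by (auto simp: \<delta>_def)
    have "B / K = ((B / K) powr (- 1 / \<alpha>)) powr (- \<alpha>)"
      using B K \<alpha> by (simp add: powr_powr)
    also have "\<dots> \<le> \<delta> powr (- \<alpha>)"
      using \<delta> \<alpha> by (intro powr_mono2') (auto simp: \<delta>_def)
    finally have B\<phi>: "B \<le> \<phi> (\<rho> / 4 + \<delta>)"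
      using K M by (simp add: \<phi>_def field_simps)
    have "u x \<le> \<phi> (norm x)"
    proof (rule annulus_comparison[OF sol p(1), where s = "\<rho> / 4 + \<delta>" and t = \<rho> and \<psi> = \<psi> and \<psi>' = \<psi>'])
      fix y :: 'a assume "norm y = \<rho> / 4 + \<delta> \<or> norm y = \<rho>"
      then show "u y \<le> \<phi> (norm y)"
      proof
        assume "norm y = \<rho> / 4 + \<delta>"
        with B(2)[of y] B\<phi> \<delta> show ?thesis by (simp add: A_def)
      next
        assume "norm y = \<rho>"
        moreover have "K * (\<rho> - \<rho> / 4) powr (- \<alpha>) \<ge> 0" using K by simp
        ultimately show ?thesis using bd[of y] by (simp add: \<phi>_def)
      qed
    next
      fix r assume "\<rho> / 4 + \<delta> < r" "r < \<rho>"
      then show "\<psi> r > 0" using K \<alpha> \<delta> by (simp add: \<psi>_def)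
    next
      fix y :: 'a assume "norm y \<le> \<rho>"
      then show "y \<in> \<Omega>" using \<Omega> by auto
    qed (use \<delta> \<rho> x d\<phi> d\<psi> super in auto)
    also have "\<dots> \<le> M + K * (\<rho> / 4) powr (- \<alpha>)"
      unfolding \<phi>_def using K x \<alpha> \<rho> by (intro add_left_mono mult_left_mono powr_mono2') auto
    also have "K * (\<rho> / 4) powr (- \<alpha>) = c * 4 powr \<alpha> * \<rho> powr (1 - l / k)"
      using \<rho> by (simp add: K_def b_def[symmetric] powr_divide powr_minus powr_add field_simps)
    finally show "u x \<le> M + c * 4 powr \<alpha> * \<rho> powr (1 - l / k)" .
  qed (use c in simp)
qed


section \<open>Logarithmic barrier\<close>

text \<open>For the logarithm the bracket in the operator is
  \<open>(N + \<sigma> - p) * (D / r\<^sup>2)\<close>, nonnegative by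
  \<open>p \<le> N + \<sigma>\<close>; strictness comes from the positive absorption. The slope
  \<open>C / ln 2\<close> makes the barrier equal \<open>M + C\<close> on the inner sphere and
  \<open>M\<close> on the outer one.\<close>

lemma log_barrier:
  fixes u :: "'a::euclidean_space \<Rightarrow> real"
  assumes sol: "positive_solution m p q \<sigma> \<tau> \<Omega> u"
    and p: "1 < p" "p \<le> real DIM('a) + \<sigma>"
    and \<Omega>: "cball 0 \<rho> \<subseteq> \<Omega>" and \<rho>: "0 < \<rho>" and C: "0 < C"
    and outer: "\<And>y. norm y = \<rho> \<Longrightarrow> u y \<le> M"
    and inner: "\<And>y. norm y = \<rho> / 2 \<Longrightarrow> u y \<le> M + C"
    and x: "\<rho> / 2 \<le> norm x" "norm x \<le> \<rho>"
  shows "u x \<le> M + C / ln 2 * ln (\<rho> / norm x)"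
proof -
  define D where "D = C / ln 2"
  have D: "D > 0" "D * ln 2 = C" using C by (auto simp: D_def)
  define \<phi> where "\<phi> = (\<lambda>r. M + D * (ln \<rho> - ln r))"
  have "u x \<le> \<phi> (norm x)"
  proof (rule annulus_comparison[OF sol p(1), where s = "\<rho> / 2" and t = \<rho> and \<psi> = "\<lambda>r. D / r"
        and \<psi>' = "\<lambda>r. - (D / r\<^sup>2)"])
    fix r v :: real assume r: "\<rho> / 2 < r" and v: "0 < v"
    have r0: "r > 0" using r \<rho> by simp
    have "(real DIM('a) - 1 + \<sigma>) * (D / r) / r + (p - 1) * - (D / r\<^sup>2)
        = (real DIM('a) + \<sigma> - p) * (D / r\<^sup>2)"
      using r0 by (simp add: power2_eq_square algebra_simps add_divide_distrib diff_divide_distrib)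
    also have "\<dots> \<ge> 0" using p D by (intro mult_nonneg_nonneg) auto
    finally have "- (r powr \<sigma> * (D / r) powr (p - 2) *
        ((real DIM('a) - 1 + \<sigma>) * (D / r) / r + (p - 1) * - (D / r\<^sup>2))) \<le> 0"
      by (simp only: neg_le_0_iff_le) (intro mult_nonneg_nonneg, auto)
    also have "0 < r powr (- \<tau>) * v powr q * (D / r) powr m"
      using r0 v D by simp
    finally show "- (r powr \<sigma> * (D / r) powr (p - 2) *
        ((real DIM('a) - 1 + \<sigma>) * (D / r) / r + (p - 1) * - (D / r\<^sup>2)))
        < r powr (- \<tau>) * v powr q * (D / r) powr m" .
  next
    fix y :: 'a assume "norm y = \<rho> / 2 \<or> norm y = \<rho>"
    then show "u y \<le> \<phi> (norm y)"
      using outer[of y] inner[of y] \<rho> D by (auto simp: \<phi>_def ln_mult algebra_simps)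
  next
    fix r assume r: "\<rho> / 2 \<le> r"
    then have r0: "r > 0" using \<rho> by simp
    show "(\<phi> has_real_derivative - (D / r)) (at r)"
      unfolding \<phi>_def using r0 by (auto intro!: derivative_eq_intros)
  next
    fix r assume r: "\<rho> / 2 < r"
    then have r0: "r > 0" using \<rho> by simp
    show "((\<lambda>r. D / r) has_real_derivative - (D / r\<^sup>2)) (at r)"
      using r0 by (auto intro!: derivative_eq_intros simp: power2_eq_square)
    show "D / r > 0" using r0 D by simp
  qed (use \<Omega> \<rho> x in auto)
  moreover have "norm x > 0" using x \<rho> by linarith
  ultimately show ?thesis
    using \<rho> by (simp add: \<phi>_def D_def ln_div)
qed

section \<open>Summation over dyadic shells\<close>

text \<open>The bound obtained on the inner sphere of a shell serves as \<open>M\<close> for the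
  next one. The increments are nonnegative, so the requirement \<open>0 \<le> M\<close> of
  \<open>step\<close> persists.\<close>

lemma dyadic_iteration:
  fixes u :: "'a::real_normed_vector \<Rightarrow> real"
  assumes step: "\<And>\<rho> M x. 0 \<le> M \<Longrightarrow> 0 < \<rho> \<Longrightarrow> \<rho> \<le> r \<Longrightarrow> (\<And>y. norm y = \<rho> \<Longrightarrow> u y \<le> M) \<Longrightarrow>
      \<rho> / 2 \<le> norm x \<Longrightarrow> norm x \<le> \<rho> \<Longrightarrow> u x \<le> M + C * \<rho> powr b"
    and M: "0 \<le> M" "\<And>y. norm y = r \<Longrightarrow> u y \<le> M" and C: "0 \<le> C"
    and x: "x \<noteq> 0" "norm x \<le> r"
  obtains j where "r / 2 ^ Suc j \<le> norm x" "norm x \<le> r / 2 ^ j"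
    and "u x \<le> M + (\<Sum>i\<le>j. C * (r / 2 ^ i) powr b)"
proof -
  have r: "r > 0" using x by (metis norm_le_zero_iff not_le order_trans)
  define S where "S = (\<lambda>j::nat. \<Sum>i<j. C * (r / 2 ^ i) powr b)"
  have S0: "S j \<ge> 0" for j unfolding S_def using C by (intro sum_nonneg) auto
  have next_shell: "u z \<le> M + S (Suc j)"
    if "\<And>y. norm y = r / 2 ^ j \<Longrightarrow> u y \<le> M + S j"
      and z: "r / 2 ^ Suc j \<le> norm z" "norm z \<le> r / 2 ^ j" for j z
  proof -
    have "u z \<le> (M + S j) + C * (r / 2 ^ j) powr b"
      by (rule step) (use that S0[of j] M(1) r in \<open>auto simp: field_simps\<close>)
    then show ?thesis by (simp add: S_def)
  qed
  have sphere: "u y \<le> M + S j" if "norm y = r / 2 ^ j" for j y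
    using that
  proof (induction j arbitrary: y)
    case 0
    then show ?case using M(2) by (simp add: S_def)
  next
    case (Suc j)
    show ?case
      by (rule next_shell[OF Suc.IH]) (use Suc.prems r in \<open>auto simp: field_simps\<close>)
  qed
  obtain n where "r / norm x < 2 ^ n"
    using real_arch_pow[of 2 "r / norm x"] by auto
  then have "r / 2 ^ Suc n \<le> norm x"
    using x r by (simp add: field_simps)
  then have ex: "\<exists>n. r / 2 ^ Suc n \<le> norm x" by blast
  \<comment> \<open>The least index picks the shell of \<open>x\<close>: its failure for the
    predecessor is the upper bound on \<open>norm x\<close>, and for index 0 that bound is the
    assumption \<open>norm x \<le> r\<close>.\<close>
  define j where "j = (LEAST n. r / 2 ^ Suc n \<le> norm x)"
  have j: "r / 2 ^ Suc j \<le> norm x" unfolding j_def by (rule LeastI_ex[OF ex])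
  have j': "norm x \<le> r / 2 ^ j"
  proof (cases j)
    case (Suc i)
    then have "\<not> r / 2 ^ Suc i \<le> norm x" using not_less_Least[of i "\<lambda>n. r / 2 ^ Suc n \<le> norm x"] by (simp add: j_def)
    with Suc show ?thesis by simp
  qed (use x in simp)
  show ?thesis
    using that[OF j j'] next_shell[OF sphere j j'] by (simp add: S_def lessThan_Suc_atMost)
qed

lemma sum_dyadic_powr:
  fixes r b :: real
  assumes "0 < r" "b \<noteq> 0"
  shows "(\<Sum>i\<le>j. (r / 2 ^ i) powr b)
    = r powr b * (1 - (2 powr (- b)) ^ Suc j) / (1 - 2 powr (- b))"
proof -
  have "(r / 2 ^ i) powr b = r powr b * (2 powr (- b)) ^ i" for i
    using assms by (simp add: powr_divide powr_minus powr_power[symmetric] powr_realpow[symmetric] powr_powr field_simps)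
  moreover have "2 powr (- b) \<noteq> 1" using assms by simp
  ultimately show ?thesis
    by (simp add: sum_distrib_left[symmetric] sum_gp0)
qed

text \<open>The increments form a geometric progression of ratio \<open>w = 2 powr (- b)\<close>.
  For b > 0 the first shell dominates, for b < 0 the last one, whose radius is comparable to
  \<open>norm x\<close>, and for b = 0 the number of shells is logarithmic in
  \<open>r / norm x\<close>.\<close>

lemma solution_bound:
  fixes m p q \<sigma> \<tau> k l :: real
  assumes k: "k = m + q - p + 1" "0 < k"
    and l: "l = q + 1 - \<sigma> - \<tau>"
    and p: "1 < p" "p \<le> real DIM('a::euclidean_space) + \<sigma>" and q: "0 \<le> q"
  obtains C where "C > 0"
    and "\<And>\<Omega> (u :: 'a \<Rightarrow> real) r M x. positive_solution m p q \<sigma> \<tau> \<Omega> u \<Longrightarrow> cball 0 r \<subseteq> \<Omega> \<Longrightarrow>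
      0 \<le> M \<Longrightarrow> (\<And>y. norm y = r \<Longrightarrow> u y \<le> M) \<Longrightarrow> x \<noteq> 0 \<Longrightarrow> norm x \<le> r \<Longrightarrow>
      u x \<le> M + C * (if l < k then r powr (1 - l / k) else if k = l then ln (r / norm x)
                      else norm x powr (1 - l / k))"
proof -
  define b where "b = 1 - l / k"
  obtain C where C: "C > 0"
    and step: "\<And>\<Omega> (u :: 'a \<Rightarrow> real) \<rho> M x. positive_solution m p q \<sigma> \<tau> \<Omega> u \<Longrightarrow> 0 \<le> M \<Longrightarrow>
      cball 0 \<rho> \<subseteq> \<Omega> \<Longrightarrow> (\<And>y. norm y = \<rho> \<Longrightarrow> u y \<le> M) \<Longrightarrow> 0 < \<rho> \<Longrightarrow>
      \<rho> / 2 \<le> norm x \<Longrightarrow> norm x \<le> \<rho> \<Longrightarrow> u x \<le> M + C * \<rho> powr b"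
    using dyadic_step[OF k l p q] unfolding b_def by metis
  define w where "w = 2 powr (- b)"
  \<comment> \<open>The factors \<open>1 / (1 - w)\<close> and \<open>w / (w - 1)\<close> bound the
    geometric sums relative to their dominant term; the 2 absorbs \<open>j + 1 \<le> 2 * j\<close>
    when \<open>k = l\<close>.\<close>
  define C' where "C' = (if k = l then 2 * C / ln 2 else if l < k then C / (1 - w) else C * w / (w - 1))"
  have b: "b > 0 \<longleftrightarrow> l < k" "b = 0 \<longleftrightarrow> k = l" "b < 0 \<longleftrightarrow> k < l"
    using k(2) by (auto simp: b_def field_simps)
  have w: "w > 0" "l < k \<Longrightarrow> w < 1" "k < l \<Longrightarrow> w > 1"
    using b powr_less_mono[of "- b" 0 2] powr_less_mono[of 0 "- b" 2] by (auto simp: w_def)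
  show ?thesis
  proof (rule that[of C'])
    show "C' > 0" using C w b by (auto simp: C'_def)
  next
    fix \<Omega> and u :: "'a \<Rightarrow> real" and r M and x :: 'a
    assume sol: "positive_solution m p q \<sigma> \<tau> \<Omega> u" and \<Omega>: "cball 0 r \<subseteq> \<Omega>"
      and M: "0 \<le> M" "\<And>y. norm y = r \<Longrightarrow> u y \<le> M" and x: "x \<noteq> 0" "norm x \<le> r"
    have r: "r > 0" using x by (metis norm_le_zero_iff not_le order_trans)
    have step': "u z \<le> M' + C * \<rho> powr b"
      if "0 \<le> M'" "0 < \<rho>" "\<rho> \<le> r" "\<And>y. norm y = \<rho> \<Longrightarrow> u y \<le> M'" "\<rho> / 2 \<le> norm z" "norm z \<le> \<rho>"
      for \<rho> M' z
      by (rule step[OF sol]) (use that \<Omega> in auto)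
    obtain j where j: "r / 2 ^ Suc j \<le> norm x" "norm x \<le> r / 2 ^ j"
      and "u x \<le> M + (\<Sum>i\<le>j. C * (r / 2 ^ i) powr b)"
      using dyadic_iteration[of r u C b M x] step' M C x by (metis less_imp_le)
    then have ux: "u x \<le> M + C * (\<Sum>i\<le>j. (r / 2 ^ i) powr b)"
      by (simp add: sum_distrib_left)
    consider "l < k" | "k = l" | "k < l" by linarith
    then have "u x \<le> M + C' * (if l < k then r powr b else if k = l then ln (r / norm x)
                      else norm x powr b)"
    proof cases
      case 1
      have "(\<Sum>i\<le>j. (r / 2 ^ i) powr b) = r powr b * ((1 - w ^ Suc j) / (1 - w))"
        using sum_dyadic_powr[OF r, of b j] 1 b by (simp add: w_def)
      also have "\<dots> \<le> r powr b * (1 / (1 - w))"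
        using w 1 by (intro mult_left_mono divide_right_mono) auto
      finally have "C * (\<Sum>i\<le>j. (r / 2 ^ i) powr b) \<le> C * (r powr b * (1 / (1 - w)))"
        using C by (intro mult_left_mono) auto
      with ux 1 show ?thesis by (simp add: C'_def)
    next
      case 3
      have "(\<Sum>i\<le>j. (r / 2 ^ i) powr b) = r powr b * ((w ^ Suc j - 1) / (w - 1))"
        using sum_dyadic_powr[OF r, of b j] 3 b w(3) by (simp add: w_def field_simps)
      also have "\<dots> \<le> r powr b * (w ^ Suc j / (w - 1))"
        using w(3) 3 by (intro mult_left_mono divide_right_mono) auto
      also have "\<dots> = (r / 2 ^ j) powr b * (w / (w - 1))"
        using r by (simp add: w_def powr_divide powr_minus powr_power[symmetric] powr_realpow[symmetric] powr_powr field_simps)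
      \<comment> \<open>As b < 0, the bound \<open>norm x \<le> r / 2 ^ j\<close> is reversed by the
        power.\<close>
      also have "\<dots> \<le> norm x powr b * (w / (w - 1))"
        using w(3) 3 b j x by (intro mult_right_mono powr_mono2') auto
      finally have "C * (\<Sum>i\<le>j. (r / 2 ^ i) powr b) \<le> C * (norm x powr b * (w / (w - 1)))"
        using C by (intro mult_left_mono) auto
      with ux 3 show ?thesis by (simp add: C'_def mult_ac)
    next
      case 2
      then have b0: "b = 0" using b by simp
      have nx: "norm x > 0" using x by simp
      show ?thesis
      proof (cases "j = 0")
        case True
        \<comment> \<open>On the outermost shell \<open>step'\<close> only gives
          \<open>M + C\<close>; applied on the sphere of radius r/2, this is the inner boundary
          value for \<open>log_barrier\<close>.\<close>
        have "u x \<le> M + C / ln 2 * ln (r / norm x)"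
          by (rule log_barrier[OF sol p \<Omega> r C M(2)])
            (use step'[OF M(1) r order_refl M(2)] b0 r j True x in auto)
        also have "\<dots> \<le> M + 2 * C / ln 2 * ln (r / norm x)"
          using C x nx r by (intro add_left_mono mult_right_mono divide_right_mono) (auto simp: ln_div)
        finally show ?thesis using 2 by (simp add: C'_def)
      next
        case False
        have "2 ^ j \<le> r / norm x" using j(2) nx by (simp add: field_simps)
        then have "ln (2 ^ j) \<le> ln (r / norm x)" using nx r by (subst ln_le_cancel_iff) auto
        then have ln: "real j * ln 2 \<le> ln (r / norm x)" by (simp add: ln_realpow)
        have "C * (\<Sum>i\<le>j. (r / 2 ^ i) powr b) = C * (real j + 1)" using b0 r by simp
        also have "\<dots> \<le> C * (2 * real j)" using C False by (intro mult_left_mono) auto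
        also have "\<dots> = 2 * C / ln 2 * (real j * ln 2)" by simp
        also have "\<dots> \<le> 2 * C / ln 2 * ln (r / norm x)" using ln C by (intro mult_left_mono) auto
        finally show ?thesis using ux 2 by (simp add: C'_def)
      qed
    qed
    then show "u x \<le> M + C' * (if l < k then r powr (1 - l / k) else if k = l then ln (r / norm x)
                      else norm x powr (1 - l / k))"
      unfolding b_def .
  qed
qed

section \<open>Maxima on spheres, local boundedness and conclusion\<close>

text \<open>Qualifies the supremum as an admissible \<open>M\<close> in
  \<open>solution_bound\<close>: compactness of the sphere bounds the image, and positivity of
  \<open>u\<close> at one point gives the sign.\<close>

lemma SUP_sphere:
  fixes u :: "'a::euclidean_space \<Rightarrow> real"
  assumes sol: "positive_solution m p q \<sigma> \<tau> \<Omega> u" and r: "0 < r" and \<Omega>: "cball 0 r \<subseteq> \<Omega>"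
  shows "0 \<le> (SUP y\<in>frontier (ball 0 r). u y)"
    and "norm y = r \<Longrightarrow> u y \<le> (SUP y\<in>frontier (ball 0 r). u y)"
proof -
  have "continuous_on (sphere 0 r) u"
    by (rule continuous_on_subset[OF positive_solution_continuous_on[OF sol]]) (use \<Omega> r in auto)
  then have "compact (u ` sphere 0 r)" by (intro compact_continuous_image) auto
  then have bdd: "bdd_above (u ` sphere 0 r)" by (intro bounded_imp_bdd_above compact_imp_bounded)
  have le: "u y \<le> (SUP y\<in>frontier (ball 0 r). u y)" if "norm y = r" for y
    using that r cSUP_upper[OF _ bdd, of y] by (simp add: frontier_ball)
  then show "norm y = r \<Longrightarrow> u y \<le> (SUP y\<in>frontier (ball 0 r). u y)" .
  obtain y :: 'a where y: "norm y = r" using r vector_choose_size[of r] by auto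
  then have "y \<in> \<Omega> - {0}" using \<Omega> r by auto
  then have "0 < u y" using sol by (auto simp: positive_solution_def)
  with le[OF y] show "0 \<le> (SUP y\<in>frontier (ball 0 r). u y)" by linarith
qed

text \<open>The value \<open>u 0\<close> is arbitrary, so continuity is used only off the origin: a
  single point affects neither measurability nor boundedness. Outside the ball of radius
  \<open>r\<close> the set is compact and avoids 0.\<close>

lemma Linfty_locI:
  fixes u :: "'a::euclidean_space \<Rightarrow> real"
  assumes cont: "continuous_on (\<Omega> - {0}) u" and r: "0 < r"
    and near: "\<And>x. x \<noteq> 0 \<Longrightarrow> norm x < r \<Longrightarrow> \<bar>u x\<bar> \<le> C"
  shows "Linfty_loc \<Omega> u"
  unfolding Linfty_loc_def
proof (intro allI impI)
  fix K assume K: "compact K \<and> K \<subseteq> \<Omega>"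
  have "u \<in> borel_measurable (lebesgue_on K)"
  proof -
    have "continuous_on (K - {0}) u" using K by (intro continuous_on_subset[OF cont]) auto
    then have "u \<in> borel_measurable (lebesgue_on (K - {0}))"
      using K by (intro continuous_imp_measurable_on_sets_lebesgue) (auto simp: lmeasurable_compact fmeasurableD)
    then have "(\<lambda>x. if x \<in> K - {0} then u x else 0) \<in> borel_measurable lebesgue"
      using K by (intro borel_measurable_if_I) (auto simp: lmeasurable_compact fmeasurableD)
    \<comment> \<open>Restores \<open>u 0\<close> in place of 0 at the origin, a change on a
      countable set.\<close>
    then have "(\<lambda>x. if x \<in> K then u x else 0) \<in> borel_measurable lebesgue"
      by (rule measurable_discrete_difference[where X = "{0}"]) auto
    then show ?thesis
      by (rule borel_measurable_if_D)
  qed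
  moreover have "bounded (u ` (K - ball 0 r))"
  proof (intro compact_imp_bounded compact_continuous_image)
    show "continuous_on (K - ball 0 r) u"
      using K r by (intro continuous_on_subset[OF cont]) auto
    show "compact (K - ball 0 r)" using K by (intro compact_diff) auto
  qed
  then obtain B where "\<forall>x\<in>K - ball 0 r. \<bar>u x\<bar> \<le> B"
    by (auto simp: bounded_iff)
  then have B: "\<bar>u x\<bar> \<le> B" if "x \<in> K - ball 0 r" for x
    using that by blast
  \<comment> \<open>The three summands cover the points outside the ball, the punctured ball and the
    origin; with \<open>\<bar>u 0\<bar>\<close> included the bound holds everywhere on
    \<open>K\<close>.\<close>
  have "\<bar>u x\<bar> \<le> \<bar>B\<bar> + \<bar>C\<bar> + \<bar>u 0\<bar>" if "x \<in> K" for x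
    using B[of x] near[of x] that by (cases "x = 0"; cases "norm x < r") auto
  then have "AE x in lebesgue_on K. \<bar>u x\<bar> \<le> \<bar>B\<bar> + \<bar>C\<bar> + \<bar>u 0\<bar>"
    by (intro AE_I2) (auto simp: space_restrict_space)
  ultimately show "u \<in> borel_measurable (lebesgue_on K) \<and> (\<exists>C. AE x in lebesgue_on K. \<bar>u x\<bar> \<le> C)"
    by blast
qed

theorem corollary2p4:
  fixes m p q \<sigma> \<tau> k l :: real
  assumes "CARD('n::finite) \<ge> 2"
    and "k = m + q - p + 1"
    and "l = q + 1 - \<sigma> - \<tau>"
    and "1 < p" and "p \<le> real CARD('n) + \<sigma>"
    and "min k l > 0"
    and "0 \<le> m" and "0 \<le> q"
  shows
    "(k > l \<longrightarrow>
        (\<forall>(\<Omega> :: (real ^ 'n) set) (u :: real ^ 'n \<Rightarrow> real).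
           open \<Omega> \<and> connected \<Omega> \<and> 0 \<in> \<Omega> \<and> positive_solution m p q \<sigma> \<tau> \<Omega> u
           \<longrightarrow> Linfty_loc \<Omega> u)) \<and>
     (k \<le> l \<longrightarrow>
        (\<exists>c\<^sub>1 > 0. \<forall>(\<Omega> :: (real ^ 'n) set) (u :: real ^ 'n \<Rightarrow> real).
           open \<Omega> \<and> connected \<Omega> \<and> 0 \<in> \<Omega> \<and> positive_solution m p q \<sigma> \<tau> \<Omega> u
           \<longrightarrow> (\<forall>r\<^sub>0 > 0. closure (ball 0 (2 * r\<^sub>0)) \<subseteq> \<Omega> \<longrightarrow>
                 (\<forall>x. 0 < norm x \<and> norm x < r\<^sub>0 \<longrightarrow>
                    u x \<le> (if k = l
                           then (SUP y\<in>frontier (ball 0 r\<^sub>0). u y) + c\<^sub>1 * ln (r\<^sub>0 / norm x)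
                           else (SUP y\<in>frontier (ball 0 r\<^sub>0). u y)
                                + c\<^sub>1 * norm x powr (1 - l / k))))))"
proof -
  have "0 < k" and "p \<le> real DIM(real ^ 'n) + \<sigma>" using assms by auto
  \<comment> \<open>One constant, obtained before any domain or solution is fixed, which expresses
    that it depends on the parameters alone.\<close>
  from solution_bound[OF assms(2) this(1) assms(3,4) this(2) assms(8)]
  obtain C where C: "C > 0"
    and bound: "\<And>\<Omega> (u :: real ^ 'n \<Rightarrow> real) r M x. positive_solution m p q \<sigma> \<tau> \<Omega> u \<Longrightarrow> cball 0 r \<subseteq> \<Omega> \<Longrightarrow>
      0 \<le> M \<Longrightarrow> (\<And>y. norm y = r \<Longrightarrow> u y \<le> M) \<Longrightarrow> x \<noteq> 0 \<Longrightarrow> norm x \<le> r \<Longrightarrow>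
      u x \<le> M + C * (if l < k then r powr (1 - l / k) else if k = l then ln (r / norm x)
                      else norm x powr (1 - l / k))"
    by metis
  show ?thesis
  proof (intro conjI impI allI exI[of _ C] C)
    fix \<Omega> :: "(real ^ 'n) set" and u :: "real ^ 'n \<Rightarrow> real"
    assume "l < k" and \<Omega>: "open \<Omega> \<and> connected \<Omega> \<and> 0 \<in> \<Omega> \<and> positive_solution m p q \<sigma> \<tau> \<Omega> u"
    then obtain r where r: "0 < r" "cball 0 r \<subseteq> \<Omega>" by (meson open_contains_cball)
    have sol: "positive_solution m p q \<sigma> \<tau> \<Omega> u" using \<Omega> by simp
    show "Linfty_loc \<Omega> u"
    proof (rule Linfty_locI[OF positive_solution_continuous_on[OF sol] r(1)])
      fix x :: "real ^ 'n" assume x: "x \<noteq> 0" "norm x < r"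
      then have "x \<in> \<Omega> - {0}" using r(2) by auto
      then have "0 < u x" using sol by (simp add: positive_solution_def)
      then show "\<bar>u x\<bar> \<le> (SUP y\<in>frontier (ball 0 r). u y) + C * r powr (1 - l / k)"
        using bound[OF sol r(2) SUP_sphere(1)[OF sol r] SUP_sphere(2)[OF sol r] x(1)] x \<open>l < k\<close>
        by simp
    qed
  next
    fix \<Omega> :: "(real ^ 'n) set" and u :: "real ^ 'n \<Rightarrow> real" and r and x :: "real ^ 'n"
    assume "k \<le> l" and \<Omega>: "open \<Omega> \<and> connected \<Omega> \<and> 0 \<in> \<Omega> \<and> positive_solution m p q \<sigma> \<tau> \<Omega> u"
      and r: "r > 0" "closure (ball 0 (2 * r)) \<subseteq> \<Omega>" and x: "0 < norm x \<and> norm x < r"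
    have sol: "positive_solution m p q \<sigma> \<tau> \<Omega> u" using \<Omega> by simp
    have r': "cball 0 r \<subseteq> \<Omega>" using r by (auto simp: subset_iff)
    have x': "x \<noteq> 0" "norm x \<le> r" using x by auto
    show "u x \<le> (if k = l
                 then (SUP y\<in>frontier (ball 0 r). u y) + C * ln (r / norm x)
                 else (SUP y\<in>frontier (ball 0 r). u y) + C * norm x powr (1 - l / k))"
      using bound[OF sol r' SUP_sphere(1)[OF sol r(1) r'] SUP_sphere(2)[OF sol r(1) r'] x'] \<open>k \<le> l\<close>
      by (simp split: if_splits)
  qed
qed

end
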